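(* Let $(X,\mathcal{B},\mu,T)$ be an ergodic measure-theoretic dynamical system and let $n\geq 2$ be an integer. Then $(X,\mathcal{B},\mu,T)$ is measure-theoretically $n$-sensitive if and only if it is measure-theoretically weakly $n$-sensitive.
   Context: A measure-theoretic dynamical system $(X,\mathcal{B},\mu,T)$ is a Lebesgue space $(X,\mathcal{B},\mu)$ (a probability space which, after completion, is isomorphic mod $0$ to an interval with Lebesgue measure together with at most countably many atoms) with an invertible measure-preserving transformation $T\colon X\to X$. It is ergodic if every $B\in\mathcal{B}$ with $T^{-1}B=B$ has $\mu(B)\in\{0,1\}$. $\mathbb{Z}_+$ denotes the non-negative integers, $\mathbb{N}$ the positive integers, $\mathcal{B}^+=\{B\in\mathcal{B}:\mu(B)>0\}$. Partitions consist of measurable sets (atoms), disjoint with union $X$. For $F\subset\mathbb{Z}_+$: $\underline{D}(F)=\liminf_{N\to\infty}\frac{\#(F\cap[0,N-1])}{N}$ (lower density) and $\overline{D}(F)=\limsup_{N\to\infty}\frac{\#(F\cap[0,N-1])}{N}$ (upper density). A finite partition $\xi$ of $X$ is $n$-sensitive if there exists $\delta>0$ such that for every $A\in\mathcal{B}^+$ there exist $n$ distinct points $x_1,\dots,x_n\in A$ and $F\subset\mathbb{Z}_+$ with $\underline{D}(F)>\delta$ such that for every $k\in F$ the points $T^kx_1,\dots,T^kx_n$ belong to (pairwise) different atoms of $\xi$. It is weakly $n$-sensitive if there exists $\delta>0$ such that for every $A\in\mathcal{B}^+$ there exist $n$ distinct points $x_1,\dots,x_n\in A$ and $F\subset\mathbb{N}$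 with $\overline{D}(F)\ge\delta$ such that for every $k\in F$ the points $T^kx_1,\dots,T^kx_n$ belong to (pairwise) different atoms of $\xi$. The system is measure-theoretically $n$-sensitive (resp. weakly $n$-sensitive) if there exists an $n$-sensitive (resp. weakly $n$-sensitive) finite partition of $X$. *)

theory Defs
  imports "HOL-Analysis.Analysis" "HOL-Probability.Probability_Measure"
begin

section \<open>Lebesgue spaces\<close>

definition isomorphic_mod_0 :: "'a measure \<Rightarrow> 'b measure \<Rightarrow> bool" where
  "isomorphic_mod_0 M N \<longleftrightarrow>
     (\<exists>A B f. A \<in> sets M \<and> B \<in> sets N \<and>
        emeasure M (space M - A) = 0 \<and> emeasure N (space N - B) = 0 \<and>
        bij_betw f A B \<and>
        f \<in> measurable (restrict_space M A) (restrict_space N B) \<and>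
        inv_into A f \<in> measurable (restrict_space N B) (restrict_space M A) \<and>
        distr (restrict_space M A) (restrict_space N B) f = restrict_space N B)"

text \<open>The interval \<open>{0..c}\<close> with Lebesgue measure (in the left summand) together with an atom of
  mass \<open>p j\<close> for each \<open>j \<in> J\<close> (in the right summand).\<close>

definition interval_with_atoms :: "real \<Rightarrow> nat set \<Rightarrow> (nat \<Rightarrow> real) \<Rightarrow> (real + nat) measure" where
  "interval_with_atoms c J p =
     measure_of (Inl ` {0..c} \<union> Inr ` J)
       {A. A \<subseteq> Inl ` {0..c} \<union> Inr ` J \<and> Inl -` A \<in> sets lebesgue}
       (\<lambda>A. emeasure lebesgue (Inl -` A) + emeasure (point_measure J (\<lambda>j. ennreal (p j))) (Inr -` A))"

text \<open>The countable set of atoms may be empty or finite, and \<open>c = 0\<close> gives the purely atomic spaces.\<close>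

definition lebesgue_probability_space :: "'a measure \<Rightarrow> bool" where
  "lebesgue_probability_space M \<longleftrightarrow>
     prob_space M \<and>
     (\<exists>c J p. 0 \<le> c \<and> (\<forall>j\<in>J. 0 < p j) \<and>
        isomorphic_mod_0 (completion M) (interval_with_atoms c J p))"

text \<open>A function given to \<^const>\<open>measure_of\<close> that is not a measure is silently replaced by \<open>0\<close>; the
  following lemmas show that this does not happen in \<^const>\<open>interval_with_atoms\<close>.\<close>

lemma sigma_algebra_interval_with_atoms:
  "sigma_algebra (Inl ` {0..c} \<union> Inr ` J)
     {A. A \<subseteq> Inl ` {0..c::real} \<union> Inr ` J \<and> Inl -` A \<in> sets lebesgue}"
  (is "sigma_algebra ?X ?S")
proof -
  have vX: "Inl -` ?X = {0..c}" by auto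
  show ?thesis
    unfolding sigma_algebra_iff2
  proof (intro conjI ballI allI impI)
    fix A assume "A \<in> ?S"
    then show "?X - A \<in> ?S"
      unfolding mem_Collect_eq vimage_Diff vX by auto
  qed (auto simp: vimage_UN)
qed

lemma space_interval_with_atoms:
  "space (interval_with_atoms c J p) = Inl ` {0..c} \<union> Inr ` J"
  unfolding interval_with_atoms_def by (rule space_measure_of) auto

lemma sets_interval_with_atoms:
  "sets (interval_with_atoms c J p) =
     {A. A \<subseteq> Inl ` {0..c} \<union> Inr ` J \<and> Inl -` A \<in> sets lebesgue}"
  unfolding interval_with_atoms_def
  by (rule sigma_algebra.sets_measure_of_eq[OF sigma_algebra_interval_with_atoms])

lemma emeasure_interval_with_atoms:
  assumes "A \<in> sets (interval_with_atoms c J p)"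
  shows "emeasure (interval_with_atoms c J p) A =
     emeasure lebesgue (Inl -` A) + emeasure (point_measure J (\<lambda>j. ennreal (p j))) (Inr -` A)"
proof (rule emeasure_measure_of[OF interval_with_atoms_def _ _ _ assms])
  let ?m = "\<lambda>A. emeasure lebesgue (Inl -` A) +
    emeasure (point_measure J (\<lambda>j. ennreal (p j))) (Inr -` A)"
  show "positive (sets (interval_with_atoms c J p)) ?m"
    by (auto simp: positive_def)
  show "countably_additive (sets (interval_with_atoms c J p)) ?m"
  proof (rule countably_additiveI)
    fix F :: "nat \<Rightarrow> (real + nat) set"
    assume F: "range F \<subseteq> sets (interval_with_atoms c J p)" "disjoint_family F"
    have disj: "disjoint_family (\<lambda>i. Inl -` F i)" "disjoint_family (\<lambda>i. Inr -` F i)"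
      using F(2) unfolding disjoint_family_on_def by blast+
    have 1: "(\<Sum>i. emeasure lebesgue (Inl -` F i)) = emeasure lebesgue (\<Union>i. Inl -` F i)"
      using F(1) disj by (intro suminf_emeasure) (auto simp: sets_interval_with_atoms)
    have "Inr -` F i \<subseteq> J" for i
      using F(1) unfolding sets_interval_with_atoms by blast
    then have 2: "(\<Sum>i. emeasure (point_measure J (\<lambda>j. ennreal (p j))) (Inr -` F i)) =
        emeasure (point_measure J (\<lambda>j. ennreal (p j))) (\<Union>i. Inr -` F i)"
      using disj by (intro suminf_emeasure) (auto simp: sets_point_measure)
    show "(\<Sum>i. ?m (F i)) = ?m (\<Union>i. F i)"
      by (simp add: suminf_add[symmetric] 1 2 vimage_UN)
  qed
qed auto

section \<open>Measure-theoretic dynamical systems\<close>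

definition invertible_measure_preserving :: "'a measure \<Rightarrow> ('a \<Rightarrow> 'a) \<Rightarrow> bool" where
  "invertible_measure_preserving M T \<longleftrightarrow>
     bij_betw T (space M) (space M) \<and>
     T \<in> measurable M M \<and> inv_into (space M) T \<in> measurable M M \<and>
     distr M M T = M"

definition mt_dynamical_system :: "'a measure \<Rightarrow> ('a \<Rightarrow> 'a) \<Rightarrow> bool" where
  "mt_dynamical_system M T \<longleftrightarrow>
     lebesgue_probability_space M \<and> invertible_measure_preserving M T"

definition ergodic_transformation :: "'a measure \<Rightarrow> ('a \<Rightarrow> 'a) \<Rightarrow> bool" where
  "ergodic_transformation M T \<longleftrightarrow>
     (\<forall>B\<in>sets M. T -` B \<inter> space M = B \<longrightarrow> measure M B \<in> {0, 1})"

section \<open>Densities and sensitivity\<close>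

definition lower_density :: "nat set \<Rightarrow> ereal" where
  "lower_density F = liminf (\<lambda>N. ereal (real (card (F \<inter> {..<N})) / real N))"

definition upper_density :: "nat set \<Rightarrow> ereal" where
  "upper_density F = limsup (\<lambda>N. ereal (real (card (F \<inter> {..<N})) / real N))"

definition finite_measurable_partition :: "'a measure \<Rightarrow> 'a set set \<Rightarrow> bool" where
  "finite_measurable_partition M \<xi> \<longleftrightarrow>
     finite \<xi> \<and> \<xi> \<subseteq> sets M \<and> partition_on (space M) \<xi>"

text \<open>An \<open>n\<close>-tuple of points is a function on \<open>{..<n}\<close>; the injective \<open>C\<close> below picks out
  the pairwise different atoms.\<close>

definition in_different_atoms :: "'a set set \<Rightarrow> nat \<Rightarrow> (nat \<Rightarrow> 'a) \<Rightarrow> bool" where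
  "in_different_atoms \<xi> n y \<longleftrightarrow>
     (\<exists>C. inj_on C {..<n} \<and> (\<forall>i<n. C i \<in> \<xi> \<and> y i \<in> C i))"

definition n_sensitive_partition ::
  "'a measure \<Rightarrow> ('a \<Rightarrow> 'a) \<Rightarrow> nat \<Rightarrow> 'a set set \<Rightarrow> bool" where
  "n_sensitive_partition M T n \<xi> \<longleftrightarrow>
     (\<exists>\<delta>>0::real. \<forall>A\<in>sets M. measure M A > 0 \<longrightarrow>
        (\<exists>x F. (\<forall>i<n. x i \<in> A) \<and> inj_on x {..<n} \<and> lower_density F > ereal \<delta> \<and>
           (\<forall>k\<in>F. in_different_atoms \<xi> n (\<lambda>i. (T ^^ k) (x i)))))"

definition weakly_n_sensitive_partition ::
  "'a measure \<Rightarrow> ('a \<Rightarrow> 'a) \<Rightarrow> nat \<Rightarrow> 'a set set \<Rightarrow> bool" where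
  "weakly_n_sensitive_partition M T n \<xi> \<longleftrightarrow>
     (\<exists>\<delta>>0::real. \<forall>A\<in>sets M. measure M A > 0 \<longrightarrow>
        (\<exists>x F. (\<forall>i<n. x i \<in> A) \<and> inj_on x {..<n} \<and> F \<subseteq> {1..} \<and> upper_density F \<ge> ereal \<delta> \<and>
           (\<forall>k\<in>F. in_different_atoms \<xi> n (\<lambda>i. (T ^^ k) (x i)))))"

definition n_sensitive :: "'a measure \<Rightarrow> ('a \<Rightarrow> 'a) \<Rightarrow> nat \<Rightarrow> bool" where
  "n_sensitive M T n \<longleftrightarrow>
     (\<exists>\<xi>. finite_measurable_partition M \<xi> \<and> n_sensitive_partition M T n \<xi>)"

definition weakly_n_sensitive :: "'a measure \<Rightarrow> ('a \<Rightarrow> 'a) \<Rightarrow> nat \<Rightarrow> bool" where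
  "weakly_n_sensitive M T n \<longleftrightarrow>
     (\<exists>\<xi>. finite_measurable_partition M \<xi> \<and> weakly_n_sensitive_partition M T n \<xi>)"

end

(* Let n-sensitivity of xi fail with small constant eps: there is a set A of positive measure on
   which every n-tuple has separation times of lower density at most eps.  Take m + 1 points of A
   and colour them, at time k, by the atoms of xi containing their images under T^k.  At each time at
   most card xi of the m + 1 points have a colour shared with no other, so the frequencies of being
   isolated, which exist almost everywhere by the pointwise ergodic theorem for the (m + 1)-fold
   product of T, sum to at most card xi, and some index i is isolated with frequency at most
   card xi / (m + 1) on a set of positive product measure.  By Fubini one can freeze the other
   m coordinates y and retain a set B of positive measure of choices for the i-th one.  If n points of
   B are separated at time k, then either one of them has a colour not occurring in y, or
   y itself carries n different colours; both happen with small frequency, so all n-tuples of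
   B have separation times of small upper density, and weak n-sensitivity fails. *)

theory Submission
  imports Defs "HOL-Probability.Infinite_Product_Measure"
begin

section \<open>Maximal inequality for sums along orbits\<close>

section \<open>The pointwise ergodic theorem\<close>

text \<open>In closed form, the maximum over j \<le> n of the sums of the first j terms of
  \<open>f\<close> along the orbit of \<open>x\<close>, with j = 0 giving 0. The recursion is the
  identity on which Garsia's argument rests.\<close>

primrec max_partial_sum :: "('a \<Rightarrow> 'a) \<Rightarrow> ('a \<Rightarrow> real) \<Rightarrow> nat \<Rightarrow> 'a \<Rightarrow> real" where
  "max_partial_sum T f 0 x = 0"
| "max_partial_sum T f (Suc n) x = max 0 (f x + max_partial_sum T f n (T x))"

lemma max_partial_sum_nonneg: "0 \<le> max_partial_sum T f n x"
  by (cases n) auto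

lemma max_partial_sum_le_Suc: "max_partial_sum T f n x \<le> max_partial_sum T f (Suc n) x"
proof (induction n arbitrary: x)
  case (Suc n)
  then show ?case
    using Suc[of "T x"] by (simp only: max_partial_sum.simps(2)[of T f _ x]) (intro max.mono add_left_mono order.refl)
qed simp

lemma partial_sum_le_max_partial_sum: "(\<Sum>k<n. f ((T ^^ k) x)) \<le> max_partial_sum T f n x"
proof (induction n arbitrary: x)
  case (Suc n)
  have "(\<Sum>k<Suc n. f ((T ^^ k) x)) = f x + (\<Sum>k<n. f ((T ^^ k) (T x)))"
    by (simp add: sum.lessThan_Suc_shift funpow_swap1 del: sum.lessThan_Suc)
  then show ?case using Suc[of "T x"] by simp
qed simp

lemma integrable_max_partial_sum:
  assumes T: "T \<in> measurable M M" "distr M M T = M" and f: "integrable M f"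
  shows "integrable M (max_partial_sum T f n)"
proof (induction n)
  case (Suc n)
  have "integrable M (\<lambda>x. max_partial_sum T f n (T x))"
    using integrable_distr[OF T(1), of "max_partial_sum T f n"] Suc T(2) by simp
  then show ?case using f by (auto simp: fun_eq_iff)
qed (simp add: fun_eq_iff)

text \<open>Garsia's argument, in a form suited to functions cut off by an invariant set: a positive
  partial sum is asked for only where \<open>f\<close> is nonzero. The functions \<open>?h n\<close>
  restrict \<open>f\<close> to the points where \<open>?G n\<close> is positive; they have
  nonnegative integrals and converge to \<open>f\<close>.\<close>

lemma maximal_ergodic:
  fixes f :: "'a \<Rightarrow> real"
  assumes T: "T \<in> measurable M M" "distr M M T = M" and f: "integrable M f"
    and pos: "\<And>x. x \<in> space M \<Longrightarrow> f x \<noteq> 0 \<Longrightarrow> \<exists>n. (\<Sum>k<n. f ((T ^^ k) x)) > 0"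
  shows "integral\<^sup>L M f \<ge> 0"
proof -
  let ?G = "max_partial_sum T f"
  let ?h = "\<lambda>n x. if ?G n x > 0 then f x else 0"
  have int: "integrable M (?G n)" "integrable M (\<lambda>x. ?G n (T x))" for n
    using integrable_max_partial_sum[OF T f]
      integrable_distr[OF T(1), of "?G n"] T(2) by simp_all
  have [measurable]: "?G n \<in> borel_measurable M" "f \<in> borel_measurable M" for n
    using int f by auto
  have inth: "integrable M (?h n)" for n
    by (rule Bochner_Integration.integrable_bound[OF f]) auto
  have "0 \<le> integral\<^sup>L M (?h (Suc n))" for n
  proof -
    have "integral\<^sup>L M (\<lambda>x. ?G (Suc n) (T x)) = integral\<^sup>L M (?G (Suc n))"
      using integral_distr[OF T(1), of "?G (Suc n)"] T(2) by simp
    \<comment> \<open>A coboundary has integral zero because \<open>T\<close> preserves the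
      measure.\<close>
    then have "0 = (\<integral>x. ?G (Suc n) x - ?G (Suc n) (T x) \<partial>M)"
      by (subst Bochner_Integration.integral_diff[OF int]) simp
    also have "\<dots> \<le> integral\<^sup>L M (?h (Suc n))"
    proof (rule integral_mono[OF Bochner_Integration.integrable_diff[OF int] inth])
      fix x
      \<comment> \<open>Where \<open>?G (Suc n) x\<close> is positive, the recursion gives
        \<open>f x = ?G (Suc n) x - ?G n (T x)\<close>, and \<open>?G n (T x)\<close> is at most
        \<open>?G (Suc n) (T x)\<close>. Elsewhere \<open>?G (Suc n) x\<close> is 0 and the left
        side is at most 0.\<close>
      show "?G (Suc n) x - ?G (Suc n) (T x) \<le> ?h (Suc n) x"
        using max_partial_sum_le_Suc[of T f n "T x"] max_partial_sum_nonneg[of T f "Suc n" "T x"]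
        by (auto simp del: max_partial_sum.simps(2) simp: not_less)
           (auto simp: max_def split: if_splits)
    qed
    finally show ?thesis .
  qed
  moreover have "(\<lambda>n. integral\<^sup>L M (?h (Suc n))) \<longlonglongrightarrow> integral\<^sup>L M f"
  proof (rule integral_dominated_convergence[where w = "\<lambda>x. \<bar>f x\<bar>"])
    show "AE x in M. (\<lambda>n. ?h (Suc n) x) \<longlonglongrightarrow> f x"
    proof (intro AE_I2 tendsto_eventually)
      fix x assume x: "x \<in> space M"
      show "\<forall>\<^sub>F n in sequentially. ?h (Suc n) x = f x"
      proof (cases "f x = 0")
        case False
        then obtain n0 where "(\<Sum>k<n0. f ((T ^^ k) x)) > 0" using pos x by blast
        then have "?G n0 x > 0" using partial_sum_le_max_partial_sum[of f T x n0] by simp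
        moreover have "?G n0 x \<le> ?G n x" if "n \<ge> n0" for n
          using lift_Suc_mono_le[of "\<lambda>n. ?G n x", OF max_partial_sum_le_Suc that] .
        ultimately show ?thesis
          unfolding eventually_sequentially
          by (intro exI[of _ n0]) (smt (verit) le_SucI)
      qed simp
    qed
  qed (use f inth borel_measurable_integrable in \<open>auto simp del: max_partial_sum.simps(2)\<close>)
  ultimately show ?thesis
    by (intro LIMSEQ_le_const) auto
qed

section \<open>Birkhoff averages and their almost everywhere convergence\<close>

definition birkhoff_avg :: "('a \<Rightarrow> 'a) \<Rightarrow> ('a \<Rightarrow> real) \<Rightarrow> nat \<Rightarrow> 'a \<Rightarrow> real" where
  "birkhoff_avg T f N x = (\<Sum>k<N. f ((T ^^ k) x)) / real N"

text \<open>The two orbit sums differ only by the end terms \<open>f ((T ^^ N) x)\<close> and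
  \<open>f x\<close>, a bounded amount that division by \<open>N\<close> sends to 0.\<close>

lemma birkhoff_avg_step_tendsto:
  assumes bound: "\<And>x. x \<in> space M \<Longrightarrow> \<bar>f x\<bar> \<le> B" and T: "T \<in> measurable M M" and x: "x \<in> space M"
  shows "(\<lambda>N. birkhoff_avg T f N (T x) - birkhoff_avg T f N x) \<longlonglongrightarrow> 0"
proof (rule Lim_null_comparison)
  have sp: "(T ^^ k) x \<in> space M" for k
    using measurable_compose_n[OF T] x by (rule measurable_space)
  have eq: "(\<Sum>k<N. f ((T ^^ k) (T x))) - (\<Sum>k<N. f ((T ^^ k) x)) = f ((T ^^ N) x) - f x" for N
    using sum_lessThan_telescope[of "\<lambda>k. f ((T ^^ k) x)" N]
    by (simp add: funpow_swap1 sum_subtractf[symmetric])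
  show "\<forall>\<^sub>F N in sequentially.
      norm (birkhoff_avg T f N (T x) - birkhoff_avg T f N x) \<le> 2 * B / real N"
  proof (intro always_eventually allI)
    fix N
    have "\<bar>f ((T ^^ N) x) - f x\<bar> \<le> 2 * B" using bound[OF sp[of N]] bound[OF x] by linarith
    then show "norm (birkhoff_avg T f N (T x) - birkhoff_avg T f N x) \<le> 2 * B / real N"
      unfolding birkhoff_avg_def diff_divide_distrib[symmetric] eq
      by (simp add: divide_right_mono)
  qed
  show "(\<lambda>N. 2 * B / real N) \<longlonglongrightarrow> 0"
    by (rule lim_const_over_n)
qed

text \<open>Adding a null sequence changes neither limit. This makes the sets on which the averages
  oscillate invariant.\<close>

lemma birkhoff_limits_invariant:
  assumes bound: "\<And>x. x \<in> space M \<Longrightarrow> \<bar>f x\<bar> \<le> B" and T: "T \<in> measurable M M" and x: "x \<in> space M"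
  shows "limsup (\<lambda>N. ereal (birkhoff_avg T f N (T x))) = limsup (\<lambda>N. ereal (birkhoff_avg T f N x))"
    and "liminf (\<lambda>N. ereal (birkhoff_avg T f N (T x))) = liminf (\<lambda>N. ereal (birkhoff_avg T f N x))"
proof -
  let ?u = "\<lambda>N. ereal (birkhoff_avg T f N (T x) - birkhoff_avg T f N x)"
  have u: "?u \<longlonglongrightarrow> 0"
    using birkhoff_avg_step_tendsto[OF assms] by (simp add: zero_ereal_def)
  have eq: "(\<lambda>N. ereal (birkhoff_avg T f N (T x))) = (\<lambda>N. ?u N + ereal (birkhoff_avg T f N x))"
    by simp
  show "limsup (\<lambda>N. ereal (birkhoff_avg T f N (T x))) = limsup (\<lambda>N. ereal (birkhoff_avg T f N x))"
    unfolding eq using ereal_limsup_lim_add[OF u, of "\<lambda>N. ereal (birkhoff_avg T f N x)"]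
    by (simp del: plus_ereal.simps)
  show "liminf (\<lambda>N. ereal (birkhoff_avg T f N (T x))) = liminf (\<lambda>N. ereal (birkhoff_avg T f N x))"
    unfolding eq using ereal_liminf_lim_add[OF u, of "\<lambda>N. ereal (birkhoff_avg T f N x)"]
    by (simp del: plus_ereal.simps)
qed

text \<open>If no partial sum of \<open>f - b\<close> were positive, all averages would be at most
  \<open>b\<close>. This and its mirror image for the lower limit feed the maximal
  inequality.\<close>

lemma birkhoff_limsup_gt:
  assumes "limsup (\<lambda>N. ereal (birkhoff_avg T f N x)) > ereal b"
  shows "\<exists>n. (\<Sum>k<n. f ((T ^^ k) x) - b) > 0"
proof (rule ccontr)
  assume "\<not> ?thesis"
  then have *: "(\<Sum>k<n. f ((T ^^ k) x)) \<le> real n * b" for n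
    by (simp add: sum_subtractf not_less)
  have "birkhoff_avg T f n x \<le> b" if "n \<ge> 1" for n
    using *[of n] that by (simp add: birkhoff_avg_def divide_le_eq mult.commute)
  then have "limsup (\<lambda>N. ereal (birkhoff_avg T f N x)) \<le> ereal b"
    by (intro Limsup_bounded) (auto simp: eventually_sequentially)
  with assms show False by simp
qed

lemma birkhoff_liminf_lt:
  assumes "liminf (\<lambda>N. ereal (birkhoff_avg T f N x)) < ereal a"
  shows "\<exists>n. (\<Sum>k<n. a - f ((T ^^ k) x)) > 0"
proof (rule ccontr)
  assume "\<not> ?thesis"
  then have *: "(\<Sum>k<n. f ((T ^^ k) x)) \<ge> real n * a" for n
    by (simp add: sum_subtractf not_less)
  have "birkhoff_avg T f n x \<ge> a" if "n \<ge> 1" for n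
    using *[of n] that by (simp add: birkhoff_avg_def le_divide_eq mult.commute)
  then have "liminf (\<lambda>N. ereal (birkhoff_avg T f N x)) \<ge> ereal a"
    by (intro Liminf_bounded) (auto simp: eventually_sequentially)
  with assms show False by simp
qed

lemma birkhoff_avg_measurable:
  assumes "T \<in> measurable M M" "f \<in> borel_measurable M"
  shows "birkhoff_avg T f N \<in> borel_measurable M"
proof -
  have "(\<lambda>x. f ((T ^^ k) x)) \<in> borel_measurable M" for k
    using measurable_comp[OF measurable_compose_n[OF assms(1)] assms(2)] by (simp add: comp_def)
  then show ?thesis
    unfolding birkhoff_avg_def[abs_def] by measurable
qed

lemma (in finite_measure) birkhoff_ergodic:
  fixes f :: "'a \<Rightarrow> real"
  assumes T: "T \<in> measurable M M" "distr M M T = M"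
    and f [measurable]: "f \<in> borel_measurable M" and bound: "\<And>x. x \<in> space M \<Longrightarrow> \<bar>f x\<bar> \<le> B"
  shows "AE x in M. convergent (\<lambda>N. birkhoff_avg T f N x)"
proof -
  let ?A = "\<lambda>x N. ereal (birkhoff_avg T f N x)"
  note birkhoff_avg_measurable[OF T(1) f, measurable]
  define D where "D a b = {x \<in> space M. liminf (?A x) < ereal a \<and> ereal b < limsup (?A x)}" for a b
  have D [measurable]: "D a b \<in> sets M" for a b
    unfolding D_def by measurable
  have "measure M (D a b) = 0" if "a < b" for a b
  proof -
    have intf: "integrable M f"
      by (rule integrable_const_bound[of _ B]) (use bound in auto)
    have inD: "(T ^^ k) x \<in> D a b" if "x \<in> D a b" for x k
    proof (induction k)
      case (Suc k)
      then show ?case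
        using birkhoff_limits_invariant[OF bound T(1), where x = "(T ^^ k) x"] measurable_space[OF T(1)]
        by (simp add: D_def)
    qed (use that in simp)
    \<comment> \<open>Orbits that start in \<open>D a b\<close> stay there, so along them the
      partial sums of the cut-off function are those of \<open>g\<close>.\<close>
    have pos: "integral\<^sup>L M (\<lambda>x. g x * indicator (D a b) x) \<ge> 0"
      if g: "integrable M g" and gpos: "\<And>x. x \<in> D a b \<Longrightarrow> \<exists>n. (\<Sum>k<n. g ((T ^^ k) x)) > 0" for g :: "'a \<Rightarrow> real"
    proof (rule maximal_ergodic[OF T])
      show "integrable M (\<lambda>x. g x * indicator (D a b) x)"
        using integrable_real_mult_indicator[OF D g] .
      fix x assume "g x * indicator (D a b) x \<noteq> (0::real)"
      then have "x \<in> D a b" by (auto simp: indicator_def split: if_splits)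
      then show "\<exists>n. 0 < (\<Sum>k<n. g ((T ^^ k) x) * indicator (D a b) ((T ^^ k) x))"
        using gpos inD by simp
    qed
    have 1: "0 \<le> integral\<^sup>L M (\<lambda>x. (f x - b) * indicator (D a b) x)"
      by (rule pos) (use intf birkhoff_limsup_gt in \<open>auto simp: D_def\<close>)
    have 2: "0 \<le> integral\<^sup>L M (\<lambda>x. (a - f x) * indicator (D a b) x)"
      by (rule pos) (use intf birkhoff_liminf_lt in \<open>auto simp: D_def\<close>)
    \<comment> \<open>Adding the two inequalities cancels \<open>f\<close>; what remains forces
      \<open>D a b\<close> to be null because \<open>a - b\<close> is negative.\<close>
    have "0 \<le> integral\<^sup>L M (\<lambda>x. (f x - b) * indicator (D a b) x)
              + integral\<^sup>L M (\<lambda>x. (a - f x) * indicator (D a b) x)"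
      using 1 2 by simp
    also have "\<dots> = integral\<^sup>L M (\<lambda>x. (a - b) * indicator (D a b) x)"
      using intf by (subst Bochner_Integration.integral_add[symmetric])
        (auto intro!: integrable_real_mult_indicator Bochner_Integration.integral_cong simp: algebra_simps)
    also have "\<dots> = (a - b) * measure M (D a b)"
      by simp
    finally show ?thesis using \<open>a < b\<close> by (simp add: zero_le_mult_iff measure_le_0_iff)
  qed
  then have null: "AE x in M. x \<notin> D a b" if "a < b" for a b
    using that by (subst AE_iff_measurable[OF D[of a b]]) (auto simp: D_def emeasure_eq_measure)
  have "AE x in M. \<forall>a\<in>\<rat>. \<forall>b\<in>\<rat>. a < b \<longrightarrow> x \<notin> D a b"
    using null by (simp add: AE_ball_countable countable_rat)
  then show ?thesis
  proof (rule AE_mp, intro AE_I2 impI)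
    fix x assume x: "x \<in> space M" and nD: "\<forall>a\<in>\<rat>. \<forall>b\<in>\<rat>. a < b \<longrightarrow> x \<notin> D a b"
    have "limsup (?A x) \<le> liminf (?A x)"
    proof (rule ccontr)
      assume "\<not> ?thesis"
      then obtain c d where cd: "liminf (?A x) < ereal c" "c < d" "ereal d < limsup (?A x)"
        by (metis ereal_dense2 ereal_less(2) less_ereal.simps(1) not_le)
      \<comment> \<open>Both thresholds must be rational, since only countably many null sets can be
        discarded.\<close>
      then obtain q where q: "q \<in> \<rat>" "c < q" "q < d" using Rats_dense_in_real by blast
      then obtain r where r: "r \<in> \<rat>" "q < r" "r < d" using Rats_dense_in_real by blast
      have "x \<in> D q r"
        unfolding D_def using x cd q r by (auto intro: less_trans[of _ "ereal c"] less_trans[of _ "ereal d"])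
      with nD q r show False by blast
    qed
    moreover have "liminf (?A x) \<le> limsup (?A x)" by (rule Liminf_le_Limsup) simp
    ultimately have eq: "limsup (?A x) = liminf (?A x)" by simp
    \<comment> \<open>Uniform bounds on the averages exclude an infinite limit.\<close>
    have "(T ^^ k) x \<in> space M" for k
      using measurable_compose_n[OF T(1)] x by (rule measurable_space)
    then have "\<bar>\<Sum>k<N. f ((T ^^ k) x)\<bar> \<le> real N * B" for N
      using bound by (intro order.trans[OF sum_abs] order.trans[OF sum_bounded_above[of _ _ B]]) auto
    moreover have "0 \<le> B" using bound[OF x] by linarith
    ultimately have b: "\<bar>birkhoff_avg T f N x\<bar> \<le> B" for N
      by (cases "N = 0") (auto simp: birkhoff_avg_def divide_le_eq mult.commute)
    obtain l where l: "?A x \<longlonglongrightarrow> l" 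
      using eq convergent_ereal by (metis convergent_def)
    have "l \<le> ereal B" 
      by (rule LIMSEQ_le_const2[OF l]) (use b in \<open>auto simp: abs_le_iff\<close>)
    moreover have "l \<ge> ereal (- B)" 
      by (rule LIMSEQ_le_const[OF l]) (use b in \<open>simp add: abs_le_iff minus_le_iff\<close>)
    ultimately obtain r where "l = ereal r" by (cases l) auto
    with l show "convergent (\<lambda>N. birkhoff_avg T f N x)" by (auto simp: convergent_def)
  qed
qed

section \<open>Densities, colourings and sections\<close>

definition freq :: "nat set \<Rightarrow> nat \<Rightarrow> real" where
  "freq F N = real (card (F \<inter> {..<N})) / real N"

lemma lower_density_eq_lim: "freq F \<longlonglongrightarrow> L \<Longrightarrow> lower_density F = ereal L"
  unfolding lower_density_def freq_def[symmetric] by (intro lim_imp_Liminf) auto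

lemma freq_mono: "F \<subseteq> G \<Longrightarrow> freq F N \<le> freq G N"
  unfolding freq_def by (intro divide_right_mono of_nat_mono card_mono) auto

lemma upper_density_mono: "F \<subseteq> G \<Longrightarrow> upper_density F \<le> upper_density G"
  unfolding upper_density_def freq_def[symmetric]
  by (intro Limsup_mono always_eventually allI) (simp add: freq_mono)

lemma lower_density_le_upper_density: "lower_density F \<le> upper_density F"
  unfolding lower_density_def upper_density_def by (rule Liminf_le_Limsup) simp

text \<open>Removing one time changes the frequency up to \<open>N\<close> by at most
  \<open>1 / real N\<close>. It reconciles the two notions of sensitivity, whose times start at 0
  and at 1.\<close>

lemma lower_density_Diff_0: "lower_density (F - {0}) = lower_density F"
proof -
  have d: "(\<lambda>N. freq F N - freq (F - {0}) N) \<longlonglongrightarrow> 0"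
  proof (rule Lim_null_comparison)
    show "\<forall>\<^sub>F N in sequentially. norm (freq F N - freq (F - {0}) N) \<le> 1 / real N"
    proof (intro always_eventually allI)
      fix N
      have e: "(F - {0}) \<inter> {..<N} = (F \<inter> {..<N}) - {0}" by blast
      have "card (F \<inter> {..<N}) \<le> card ((F - {0}) \<inter> {..<N}) + 1"
        unfolding e by (metis card_Diff1_le card_Suc_Diff1 card.infinite Diff_empty
            Diff_insert0 Suc_eq_plus1 le_add1 le_refl finite_Int finite_lessThan)
      moreover have "card ((F - {0}) \<inter> {..<N}) \<le> card (F \<inter> {..<N})"
        by (intro card_mono) auto
      ultimately show "norm (freq F N - freq (F - {0}) N) \<le> 1 / real N"
        unfolding freq_def diff_divide_distrib[symmetric] by (auto intro!: divide_right_mono)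
    qed
  qed (rule lim_const_over_n)
  then have d': "(\<lambda>N. ereal (freq F N - freq (F - {0}) N)) \<longlonglongrightarrow> 0"
    by (simp add: zero_ereal_def)
  have "lower_density F = liminf (\<lambda>N. ereal (freq F N - freq (F - {0}) N) + ereal (freq (F - {0}) N))"
    by (simp add: lower_density_def freq_def)
  also have "\<dots> = lower_density (F - {0})"
    using ereal_liminf_lim_add[OF d', of "\<lambda>N. ereal (freq (F - {0}) N)"]
    by (simp add: lower_density_def freq_def del: plus_ereal.simps)
  finally show ?thesis by simp
qed

lemma freq_UN_le:
  assumes "finite A" "F \<subseteq> (\<Union>a\<in>A. P a)"
  shows "freq F N \<le> (\<Sum>a\<in>A. freq (P a) N)"
proof -
  have "card (F \<inter> {..<N}) \<le> card (\<Union>a\<in>A. P a \<inter> {..<N})"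
    using assms by (intro card_mono) auto
  also have "\<dots> \<le> (\<Sum>a\<in>A. card (P a \<inter> {..<N}))"
    by (rule card_UN_le[OF assms(1)])
  finally have "real (card (F \<inter> {..<N})) \<le> (\<Sum>a\<in>A. real (card (P a \<inter> {..<N})))"
    by (simp flip: of_nat_sum)
  then show ?thesis
    unfolding freq_def by (simp add: divide_right_mono flip: sum_divide_distrib)
qed

lemma upper_density_le:
  assumes "\<And>N. freq F N \<le> g N" "g \<longlonglongrightarrow> L" "L \<le> c"
  shows "upper_density F \<le> ereal c"
proof -
  have "upper_density F \<le> limsup (\<lambda>N. ereal (g N))"
    unfolding upper_density_def freq_def[symmetric]
    by (intro Limsup_mono always_eventually allI) (simp add: assms)
  also have "\<dots> = ereal L"
    using assms by (intro lim_imp_Limsup) auto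
  finally show ?thesis using assms(3) by (meson ereal_less_eq(3) order.trans)
qed

text \<open>Double counting of the pairs (i, k) with k < N and k in \<open>P i\<close>.\<close>

lemma sum_freq_le:
  assumes "finite I" "\<And>k. card {i \<in> I. k \<in> P i} \<le> c"
  shows "(\<Sum>i\<in>I. freq (P i) N) \<le> real c"
proof -
  have "(\<Sum>i\<in>I. card (P i \<inter> {..<N})) = (\<Sum>k<N. card {i \<in> I. k \<in> P i})"
  proof -
    have "(\<Sum>i\<in>I. card (P i \<inter> {..<N})) = (\<Sum>i\<in>I. \<Sum>k<N. if k \<in> P i then 1 else 0)"
      by (intro sum.cong) (auto simp: sum.If_cases Int_commute Int_def)
    also have "\<dots> = (\<Sum>k<N. \<Sum>i\<in>I. if k \<in> P i then 1 else 0)"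
      by (rule sum.swap)
    also have "\<dots> = (\<Sum>k<N. card {i \<in> I. k \<in> P i})"
      using assms(1) by (intro sum.cong) (auto simp: sum.If_cases Int_def)
    finally show ?thesis .
  qed
  also have "\<dots> \<le> N * c"
    using sum_bounded_above[of "{..<N}" "\<lambda>k. card {i \<in> I. k \<in> P i}" c] assms(2) by simp
  finally have "(\<Sum>i\<in>I. real (card (P i \<inter> {..<N}))) \<le> real N * real c"
    by (metis of_nat_le_iff of_nat_mult of_nat_sum)
  then show ?thesis
    unfolding freq_def by (cases "N = 0") (auto simp: divide_le_eq mult.commute simp flip: sum_divide_distrib)
qed

lemma birkhoff_avg_indicator:
  "birkhoff_avg T (indicator B) N x = freq {k. (T ^^ k) x \<in> B} N"
proof -
  have "(\<Sum>k<N. indicator B ((T ^^ k) x) :: real) = (\<Sum>k<N. if k \<in> {k. (T ^^ k) x \<in> B} then 1 else 0)"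
    by (intro sum.cong) (auto simp: indicator_def)
  also have "\<dots> = real (card ({k. (T ^^ k) x \<in> B} \<inter> {..<N}))"
    by (subst sum.If_cases) (auto simp: Int_commute)
  finally show ?thesis unfolding birkhoff_avg_def freq_def by simp
qed

lemma (in finite_measure) birkhoff_freq:
  assumes "T \<in> measurable M M" "distr M M T = M" "B \<in> sets M"
  shows "AE x in M. convergent (freq {k. (T ^^ k) x \<in> B})"
  using birkhoff_ergodic[OF assms(1,2), of "indicator B" 1] assms(3)
  by (auto simp: birkhoff_avg_indicator indicator_def)

section \<open>Product maps, colourings and sections\<close>

lemma compose_funpow_apply:
  fixes T :: "'a \<Rightarrow> 'a"
  shows "i \<in> I \<Longrightarrow> (compose I T ^^ k) z i = (T ^^ k) (z i)"
  by (induction k) (auto simp: compose_def)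

text \<open>Isolated indices have pairwise different colours, so \<open>c\<close> is injective on
  them.\<close>

lemma card_isolated_le:
  fixes c :: "'i \<Rightarrow> 'c"
  assumes "finite K" "c ` I \<subseteq> K"
  shows "card {i \<in> I. \<forall>j\<in>I - {i}. c j \<noteq> c i} \<le> card K"
  by (rule card_inj_on_le[OF _ _ assms(1)]) (use assms(2) in \<open>auto simp: inj_on_def\<close>)

text \<open>If every colour of \<open>d\<close> occurs on \<open>I\<close>, then choosing one index
  for each of these \<open>n\<close> colours yields \<open>J\<close>.\<close>

lemma injective_colours_cases:
  fixes c :: "'i \<Rightarrow> 'c" and d :: "nat \<Rightarrow> 'c"
  assumes "finite I" "inj_on d {..<n}"
  shows "(\<exists>l<n. d l \<notin> c ` I) \<or> (\<exists>J\<subseteq>I. card J = n \<and> inj_on c J)"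
proof (cases "\<exists>l<n. d l \<notin> c ` I")
  case False
  then have sub: "d ` {..<n} \<subseteq> c ` I" by auto
  define J where "J = inv_into I c ` d ` {..<n}"
  have "J \<subseteq> I" unfolding J_def using sub inv_into_into[of _ c I] by blast
  moreover have "inj_on (inv_into I c) (d ` {..<n})"
    using sub by (rule inj_on_inv_into)
  then have "card J = n"
    unfolding J_def using assms(2) by (simp add: card_image)
  moreover have "inj_on c J"
    unfolding J_def using sub by (auto simp: inj_on_def f_inv_into_f subset_iff image_iff)
  ultimately show ?thesis by blast
qed simp

text \<open>By Fubini the measure of \<open>W\<close> is the integral over \<open>y\<close> of the
  measures of its sections in direction \<open>i\<close>, which therefore cannot all vanish.\<close>

lemma PiM_section_pos:
  fixes M :: "'a measure"
  assumes "prob_space M" "finite I" "i \<in> I"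
    and W: "W \<in> sets (PiM I (\<lambda>_. M))" "emeasure (PiM I (\<lambda>_. M)) W > 0"
  shows "\<exists>y \<in> space (PiM (I - {i}) (\<lambda>_. M)). {x \<in> space M. y(i := x) \<in> W} \<in> sets M \<and>
           emeasure M {x \<in> space M. y(i := x) \<in> W} > 0"
proof -
  interpret prob_space M by fact
  interpret product_prob_space "\<lambda>_. M" I ..
  let ?I = "I - {i}"
  have ins: "insert i ?I = I" using \<open>i \<in> I\<close> by blast
  have sec: "{x \<in> space M. y(i := x) \<in> W} \<in> sets M" if "y \<in> space (PiM ?I (\<lambda>_. M))" for y
  proof -
    have "(\<lambda>x. y(i := x)) \<in> measurable M (PiM I (\<lambda>_. M))"
      using measurable_component_update[OF that, of i] ins by simp
    from measurable_sets[OF this W(1)] show ?thesis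
      by (simp add: vimage_def Int_def conj_commute)
  qed
  have "emeasure (PiM I (\<lambda>_. M)) W =
      (\<integral>\<^sup>+ y. (\<integral>\<^sup>+ x. indicator W (y(i := x)) \<partial>M) \<partial>PiM ?I (\<lambda>_. M))"
    using product_nn_integral_insert[of ?I i "indicator W"] assms(2) W(1) ins by simp
  also have "\<dots> = (\<integral>\<^sup>+ y. emeasure M {x \<in> space M. y(i := x) \<in> W} \<partial>PiM ?I (\<lambda>_. M))"
  proof (rule nn_integral_cong)
    fix y assume y: "y \<in> space (PiM ?I (\<lambda>_. M))"
    have "(\<integral>\<^sup>+ x. indicator W (y(i := x)) \<partial>M) =
        (\<integral>\<^sup>+ x. indicator {x \<in> space M. y(i := x) \<in> W} x \<partial>M)"
      by (rule nn_integral_cong) (auto simp: indicator_def)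
    then show "(\<integral>\<^sup>+ x. indicator W (y(i := x)) \<partial>M) = emeasure M {x \<in> space M. y(i := x) \<in> W}"
      using sec[OF y] by simp
  qed
  finally have eq: "emeasure (PiM I (\<lambda>_. M)) W = \<dots>" .
  show ?thesis
  proof (rule ccontr)
    assume "\<not> ?thesis"
    then have "emeasure M {x \<in> space M. y(i := x) \<in> W} = 0" if "y \<in> space (PiM ?I (\<lambda>_. M))" for y
      using sec that by (auto simp: not_gr_zero)
    then have "emeasure (PiM I (\<lambda>_. M)) W = (\<integral>\<^sup>+ y. 0 \<partial>PiM ?I (\<lambda>_. M))"
      unfolding eq by (intro nn_integral_cong)
    with W(2) show False by simp
  qed
qed

section \<open>From small lower densities to small upper densities\<close>

section \<open>Refining a set of small lower densities\<close>

text \<open>The first summand of the bound has one term for each n-subset of the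
  \<open>m + 1\<close> indices, the second one term for each of the \<open>n\<close> new points. The
  free \<open>m\<close> is to be taken large for the second summand, and \<open>\<epsilon>\<close>
  small afterwards for the first. Lower densities turn into upper ones because almost everywhere the
  frequencies converge.\<close>

lemma (in prob_space) refine_to_small_upper_density:
  fixes T :: "'a \<Rightarrow> 'a" and col :: "'a \<Rightarrow> 'c" and \<epsilon> :: real and m n :: nat
  assumes T: "T \<in> measurable M M" "distr M M T = M"
    and K: "finite K" "col \<in> measurable M (count_space K)"
    and A: "A \<in> sets M" "emeasure M A > 0" and "n > 0"
    and small: "\<And>x. (\<And>i. i < n \<Longrightarrow> x i \<in> A) \<Longrightarrow>
      lower_density {k. inj_on (\<lambda>i. col ((T ^^ k) (x i))) {..<n}} \<le> ereal \<epsilon>"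
  shows "\<exists>A'\<in>sets M. emeasure M A' > 0 \<and> (\<forall>x. (\<forall>i<n. x i \<in> A') \<longrightarrow>
      upper_density {k. inj_on (\<lambda>i. col ((T ^^ k) (x i))) {..<n}}
        \<le> ereal (card {J. J \<subseteq> {..m} \<and> card J = n} * \<epsilon> + n * (card K / real (Suc m))))"
proof -
  define I where "I = {..m}"
  define JJ where "JJ = {J. J \<subseteq> I \<and> card J = n}"
  define P where "P = PiM I (\<lambda>_. M)"
  \<comment> \<open>The product map: \<open>T\<close> in each coordinate of \<open>I\<close>, and
    \<open>undefined\<close> elsewhere as \<open>PiE\<close> demands.\<close>
  define S where "S = compose I T"
  define c where "c = card K / real (Suc m)"
  have fin: "finite I" "finite JJ" "card I = Suc m" unfolding I_def JJ_def by auto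
  interpret PP: product_prob_space "\<lambda>_. M" I ..
  interpret P: prob_space P unfolding P_def by (rule prob_space_PiM) unfold_locales
  have S: "S \<in> measurable P P" "distr P P S = P"
    using distr_PiM_finite_prob_space[OF fin(1) PP.product_prob_space_axioms PP.product_prob_space_axioms, of T] T
    unfolding P_def S_def compose_def by auto
  have spP: "space P = PiE I (\<lambda>_. space M)" unfolding P_def by (simp add: space_PiM)
  have Sk: "(S ^^ k) z \<in> space P" if "z \<in> space P" for k z
    using measurable_compose_n[OF S(1)] that by (rule measurable_space)
  have Sk_apply: "(S ^^ k) z i = (T ^^ k) (z i)" if "i \<in> I" for k z i
    using that unfolding S_def by (rule compose_funpow_apply)
  have colK: "col x \<in> K" if "x \<in> space M" for x
    using measurable_space[OF K(2) that] by simp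
  define sep where "sep J = {z \<in> space P. inj_on (\<lambda>i. col (z i)) J}" for J
  define iso where "iso i = {z \<in> space P. \<forall>j\<in>I - {i}. col (z j) \<noteq> col (z i)}" for i
  have ne: "{z \<in> space P. col (z i) \<noteq> col (z j)} \<in> sets P" if "i \<in> I" "j \<in> I" for i j
  proof -
    have [measurable]: "(\<lambda>z. col (z i)) \<in> measurable P (count_space K)" if "i \<in> I" for i
      using measurable_comp[OF measurable_component_singleton[OF that, of "\<lambda>_. M"] K(2)]
      unfolding P_def comp_def .
    have "col (z i) \<in> K" if "z \<in> space P" for z
      using that \<open>i \<in> I\<close> colK by (auto simp: spP)
    then have "{z \<in> space P. col (z i) \<noteq> col (z j)} =
        space P - (\<Union>C\<in>K. {z \<in> space P. col (z i) = C} \<inter> {z \<in> space P. col (z j) = C})"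
      by auto metis
    also have "\<dots> \<in> sets P"
      using that K(1) by (intro sets.Diff sets.finite_UN sets.Int sets.top) measurable
    finally show ?thesis .
  qed
  have sep_sets: "sep J \<in> sets P" if "J \<subseteq> I" for J
  proof -
    have "finite J" using that fin(1) by (rule finite_subset)
    have "sep J = {z \<in> space P. \<forall>i\<in>J. \<forall>j\<in>J - {i}. col (z i) \<noteq> col (z j)}"
      unfolding sep_def by (auto simp: inj_on_def)
    also have "\<dots> \<in> sets P"
      using \<open>finite J\<close> that by (intro sets.sets_Collect_finite_All ne) auto
    finally show ?thesis .
  qed
  have iso_sets: "iso i \<in> sets P" if "i \<in> I" for i
    unfolding iso_def using that fin(1) by (intro sets.sets_Collect_finite_All ne) auto
  define Fs where "Fs z J = {k. (S ^^ k) z \<in> sep J}" for z J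
  define Fi where "Fi z i = {k. (S ^^ k) z \<in> iso i}" for z i
  \<comment> \<open>Only finitely many sets are involved, so one null set \<open>N\<close> serves
    all \<open>J\<close> and all \<open>i\<close>.\<close>
  have "AE z in P. (\<forall>J\<in>JJ. convergent (freq (Fs z J))) \<and> (\<forall>i\<in>I. convergent (freq (Fi z i)))"
    using fin sep_sets iso_sets unfolding Fs_def Fi_def
    by (intro AE_conjI AE_finite_allI P.birkhoff_freq[OF S]) (auto simp: JJ_def)
  then obtain N where N': "{z \<in> space P. \<not> ((\<forall>J\<in>JJ. convergent (freq (Fs z J))) \<and>
      (\<forall>i\<in>I. convergent (freq (Fi z i))))} \<subseteq> N" "emeasure P N = 0" "N \<in> sets P"
    by (rule AE_E)
  then have N: "N \<in> null_sets P" by auto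
  have conv: "(\<forall>J\<in>JJ. convergent (freq (Fs z J))) \<and> (\<forall>i\<in>I. convergent (freq (Fi z i)))"
    if "z \<in> space P - N" for z
    using N'(1) that by blast
  \<comment> \<open>A condition on \<open>lower_density\<close> is measurable, being one on a liminf
    of Birkhoff averages; off \<open>N\<close> it bounds a true limit.\<close>
  define W where "W i = {z \<in> PiE I (\<lambda>_. A) - N. lower_density (Fi z i) \<le> ereal c}" for i
  have PiEA: "PiE I (\<lambda>_. A) \<in> sets P" "PiE I (\<lambda>_. A) \<subseteq> space P"
    unfolding P_def using fin A(1) sets.sets_into_space[OF A(1)] 
    by (auto intro!: sets_PiM_I_finite simp: space_PiM)
  have W_sets: "W i \<in> sets P" if "i \<in> I" for i
  proof -
    have [measurable]: "birkhoff_avg S (indicator (iso i)) n \<in> borel_measurable P" for n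
      using birkhoff_avg_measurable[OF S(1)] iso_sets[OF that] by simp
    have "{z \<in> space P. liminf (\<lambda>n. ereal (birkhoff_avg S (indicator (iso i)) n z)) \<le> ereal c} \<in> sets P"
      by measurable
    moreover have "W i = (PiE I (\<lambda>_. A) - N) \<inter>
        {z \<in> space P. liminf (\<lambda>n. ereal (birkhoff_avg S (indicator (iso i)) n z)) \<le> ereal c}"
      using PiEA(2) unfolding W_def lower_density_def freq_def[symmetric] birkhoff_avg_indicator Fi_def
      by auto
    ultimately show ?thesis using N PiEA(1) by auto
  qed
  have limFi: "\<exists>l. freq (Fi z i) \<longlonglongrightarrow> l" if "z \<in> space P - N" "i \<in> I" for z i
    using conv[OF that(1)] that(2) by (auto simp: convergent_def)
  \<comment> \<open>The limiting isolation frequencies of the \<open>Suc m\<close> indices sum to at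
    most \<open>card K\<close>, so one of them is at most the mean value \<open>c\<close>.\<close>
  have cover: "PiE I (\<lambda>_. A) - N \<subseteq> (\<Union>i\<in>I. W i)"
  proof
    fix z assume z: "z \<in> PiE I (\<lambda>_. A) - N"
    then have zP: "z \<in> space P - N" using PiEA by auto
    from limFi[OF zP] obtain l where l: "\<And>i. i \<in> I \<Longrightarrow> freq (Fi z i) \<longlonglongrightarrow> l i" by metis
    have "card {i \<in> I. k \<in> Fi z i} \<le> card K" for k
    proof -
      have "{i \<in> I. k \<in> Fi z i} =
          {i \<in> I. \<forall>j\<in>I - {i}. col ((S ^^ k) z j) \<noteq> col ((S ^^ k) z i)}"
        using Sk zP by (auto simp: Fi_def iso_def)
      also have "card \<dots> \<le> card K"
        using Sk[of z k] zP colK by (intro card_isolated_le K(1)) (auto simp: spP PiE_iff)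
      finally show ?thesis .
    qed
    then have "(\<Sum>i\<in>I. freq (Fi z i) N) \<le> card K" for N
      using fin(1) by (intro sum_freq_le) auto
    moreover have "(\<lambda>N. \<Sum>i\<in>I. freq (Fi z i) N) \<longlonglongrightarrow> (\<Sum>i\<in>I. l i)"
      by (intro tendsto_sum l)
    ultimately have "(\<Sum>i\<in>I. l i) \<le> card K"
      by (intro LIMSEQ_le_const2) auto
    then have "\<exists>i\<in>I. l i \<le> c"
      using sum_strict_mono[of I "\<lambda>_. c" l] fin by (fastforce simp: c_def not_le)
    then obtain i where "i \<in> I" "l i \<le> c" by blast
    then show "z \<in> (\<Union>i\<in>I. W i)"
      using z lower_density_eq_lim[OF l[of i]] by (auto simp: W_def intro!: bexI[of _ i])
  qed
  have "emeasure P (PiE I (\<lambda>_. A)) = emeasure M A ^ card I"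
    unfolding P_def using PP.emeasure_PiM[OF fin(1), of "\<lambda>_. A"] A(1) by simp
  then have "emeasure P (PiE I (\<lambda>_. A)) > 0"
    using A(2) by (metis not_gr_zero power_not_zero)
  also have "emeasure P (PiE I (\<lambda>_. A)) = emeasure P (PiE I (\<lambda>_. A) - N)"
    using emeasure_Diff_null_set[OF N PiEA(1)] by simp
  also have "\<dots> \<le> emeasure P (\<Union>i\<in>I. W i)"
    using cover W_sets fin(1) by (intro emeasure_mono) auto
  also have "\<dots> \<le> (\<Sum>i\<in>I. emeasure P (W i))"
    using W_sets fin(1) by (intro emeasure_subadditive_finite) auto
  finally obtain i where i: "i \<in> I" and Wi: "emeasure P (W i) > 0"
    by (metis not_gr_zero sum.neutral)
  \<comment> \<open>The coordinates other than \<open>i\<close> are frozen at \<open>y\<close>; the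
    section in direction \<open>i\<close> is the refined set.\<close>
  obtain y where y: "{x \<in> space M. y(i := x) \<in> W i} \<in> sets M"
      "emeasure M {x \<in> space M. y(i := x) \<in> W i} > 0"
    using PiM_section_pos[OF prob_space_axioms fin(1) i, of "W i"] W_sets[OF i] Wi unfolding P_def by blast
  show ?thesis
  proof (intro bexI[OF _ y(1)] conjI y(2) allI impI)
    fix x assume x: "\<forall>l<n. x l \<in> {x \<in> space M. y(i := x) \<in> W i}"
    define w where "w l = y(i := x l)" for l
    have w: "w l \<in> W i" "w l \<in> space P - N" "w l \<in> PiE I (\<lambda>_. A)" if "l < n" for l
      using x that PiEA by (auto simp: w_def W_def)
    let ?F = "{k. inj_on (\<lambda>i. col ((T ^^ k) (x i))) {..<n}}"
    have Fs_eq: "Fs (w 0) J = {k. inj_on (\<lambda>j. col ((T ^^ k) (w 0 j))) J}" if "J \<subseteq> I" for J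
      using Sk[of "w 0"] w(2)[of 0] \<open>n > 0\<close> that
      by (auto simp: Fs_def sep_def Sk_apply subset_iff cong: inj_on_cong)
    have "\<exists>s. freq (Fs (w 0) J) \<longlonglongrightarrow> s \<and> s \<le> \<epsilon>" if J: "J \<in> JJ" for J
    proof -
      have JI: "J \<subseteq> I" "card J = n" using J by (auto simp: JJ_def)
      obtain s where s: "freq (Fs (w 0) J) \<longlonglongrightarrow> s"
        using conv[OF w(2)[of 0]] \<open>n > 0\<close> J by (auto simp: convergent_def)
      \<comment> \<open>Enumerating \<open>J\<close> makes its coordinates an n-tuple in
        \<open>A\<close>, to which \<open>small\<close> applies.\<close>
      obtain h where h: "bij_betw h {..<n} J"
        using ex_bij_betw_nat_finite[of J] finite_subset[OF JI(1) fin(1)] JI(2)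
        by (auto simp: lessThan_atLeast0)
      have "inj_on (\<lambda>j. col ((T ^^ k) (w 0 j))) J \<longleftrightarrow>
          inj_on (\<lambda>i. col ((T ^^ k) (w 0 (h i)))) {..<n}" for k
        using comp_inj_on_iff[of h "{..<n}" "\<lambda>j. col ((T ^^ k) (w 0 j))"] h
        by (simp add: bij_betw_def comp_def)
      then have "Fs (w 0) J = {k. inj_on (\<lambda>i. col ((T ^^ k) (w 0 (h i)))) {..<n}}"
        using Fs_eq[OF JI(1)] by simp
      moreover have "w 0 (h l) \<in> A" if "l < n" for l
        using w(3)[of 0] \<open>n > 0\<close> h JI(1) that by (auto simp: bij_betw_def PiE_iff)
      ultimately have "lower_density (Fs (w 0) J) \<le> ereal \<epsilon>"
        using small[of "\<lambda>l. w 0 (h l)"] by simp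
      with s show ?thesis using lower_density_eq_lim[OF s] by auto
    qed
    then obtain s where s: "\<And>J. J \<in> JJ \<Longrightarrow> freq (Fs (w 0) J) \<longlonglongrightarrow> s J \<and> s J \<le> \<epsilon>" by metis
    have "\<exists>t. freq (Fi (w l) i) \<longlonglongrightarrow> t \<and> t \<le> c" if "l < n" for l
      using limFi[OF w(2)[OF that] i] w(1)[OF that] lower_density_eq_lim by (fastforce simp: W_def)
    then obtain t where t: "\<And>l. l < n \<Longrightarrow> freq (Fi (w l) i) \<longlonglongrightarrow> t l \<and> t l \<le> c" by metis
    have "?F \<subseteq> (\<Union>J\<in>JJ. Fs (w 0) J) \<union> (\<Union>l<n. Fi (w l) i)"
    proof
      fix k assume "k \<in> ?F"
      then have inj: "inj_on (\<lambda>i. col ((T ^^ k) (x i))) {..<n}" by simp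
      let ?c = "\<lambda>j. col ((T ^^ k) (y j))"
      from injective_colours_cases[OF _ inj, of "I - {i}" ?c] fin(1)
      consider l where "l < n" "col ((T ^^ k) (x l)) \<notin> ?c ` (I - {i})"
        | J where "J \<subseteq> I - {i}" "card J = n" "inj_on ?c J" by auto
      then show "k \<in> (\<Union>J\<in>JJ. Fs (w 0) J) \<union> (\<Union>l<n. Fi (w l) i)"
      proof cases
        case 1
        then have "\<forall>j\<in>I - {i}. ?c j \<noteq> col ((T ^^ k) (x l))"
          by (metis imageI)
        then have "k \<in> Fi (w l) i"
          using 1(1) Sk[of "w l" k] w(2)[of l] i by (auto simp: Fi_def iso_def Sk_apply w_def)
        with 1 show ?thesis by auto
      next
        case 2
        then have "inj_on (\<lambda>j. col ((T ^^ k) (w 0 j))) J"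
          by (auto simp: w_def inj_on_def)
        then have "k \<in> Fs (w 0) J" using Fs_eq[of J] 2 by auto
        with 2 show ?thesis by (auto simp: JJ_def)
      qed
    qed
    \<comment> \<open>The index type \<open>bool\<close> specialises the union bound to two
      sets.\<close>
    then have "freq ?F N \<le> freq (\<Union>J\<in>JJ. Fs (w 0) J) N + freq (\<Union>l<n. Fi (w l) i) N" for N
      using freq_UN_le[of "UNIV :: bool set" ?F
          "\<lambda>b. if b then (\<Union>J\<in>JJ. Fs (w 0) J) else (\<Union>l<n. Fi (w l) i)" N]
      by (simp add: UNIV_bool Un_commute)
    also have "freq (\<Union>J\<in>JJ. Fs (w 0) J) N + freq (\<Union>l<n. Fi (w l) i) N \<le>
        (\<Sum>J\<in>JJ. freq (Fs (w 0) J) N) + (\<Sum>l<n. freq (Fi (w l) i) N)" for N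
      using fin(2) by (intro add_mono freq_UN_le) auto
    finally have "freq ?F N \<le> (\<Sum>J\<in>JJ. freq (Fs (w 0) J) N) + (\<Sum>l<n. freq (Fi (w l) i) N)" for N .
    moreover have "(\<lambda>N. (\<Sum>J\<in>JJ. freq (Fs (w 0) J) N) + (\<Sum>l<n. freq (Fi (w l) i) N))
        \<longlonglongrightarrow> (\<Sum>J\<in>JJ. s J) + (\<Sum>l<n. t l)"
      using s t by (intro tendsto_add tendsto_sum) auto
    moreover have "(\<Sum>J\<in>JJ. s J) + (\<Sum>l<n. t l) \<le> card JJ * \<epsilon> + n * c"
      using s t sum_bounded_above[of JJ s \<epsilon>] sum_bounded_above[of "{..<n}" t c]
      by (intro add_mono) auto
    ultimately have "upper_density ?F \<le> ereal (card JJ * \<epsilon> + n * c)"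
      by (rule upper_density_le)
    then show "upper_density ?F
        \<le> ereal (card {J. J \<subseteq> {..m} \<and> card J = n} * \<epsilon> + n * (card K / real (Suc m)))"
      by (simp add: JJ_def I_def c_def)
  qed
qed

section \<open>Sensitivity of partitions\<close>

definition atom_of :: "'a set set \<Rightarrow> 'a \<Rightarrow> 'a set" where
  "atom_of \<xi> x = (THE C. C \<in> \<xi> \<and> x \<in> C)"

lemma atom_of_eq:
  assumes "partition_on X \<xi>" "C \<in> \<xi>" "x \<in> C"
  shows "atom_of \<xi> x = C"
  unfolding atom_of_def using assms
  by (intro the_equality) (auto simp: partition_on_def disjoint_def)

lemma atom_of_mem:
  assumes "partition_on X \<xi>" "x \<in> X"
  shows "atom_of \<xi> x \<in> \<xi>" "x \<in> atom_of \<xi> x"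
proof -
  obtain C where "C \<in> \<xi>" "x \<in> C" using assms by (auto simp: partition_on_def)
  then show "atom_of \<xi> x \<in> \<xi>" "x \<in> atom_of \<xi> x" using atom_of_eq[OF assms(1)] by auto
qed

text \<open>Atoms are disjoint, so the witness \<open>C i\<close> can only be the atom of
  \<open>y i\<close>; separation thus becomes injectivity of a colouring.\<close>

lemma in_different_atoms_iff:
  assumes "partition_on X \<xi>" "\<And>i. i < n \<Longrightarrow> y i \<in> X"
  shows "in_different_atoms \<xi> n y \<longleftrightarrow> inj_on (\<lambda>i. atom_of \<xi> (y i)) {..<n}"
proof
  assume "in_different_atoms \<xi> n y"
  then obtain C where C: "inj_on C {..<n}" "\<forall>i<n. C i \<in> \<xi> \<and> y i \<in> C i"
    by (auto simp: in_different_atoms_def)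
  then have "atom_of \<xi> (y i) = C i" if "i \<in> {..<n}" for i
    using that atom_of_eq[OF assms(1)] by simp
  with C(1) show "inj_on (\<lambda>i. atom_of \<xi> (y i)) {..<n}"
    using inj_on_cong[of "{..<n}" "\<lambda>i. atom_of \<xi> (y i)" C] by simp
next
  assume "inj_on (\<lambda>i. atom_of \<xi> (y i)) {..<n}"
  then show "in_different_atoms \<xi> n y"
    using atom_of_mem[OF assms(1) assms(2)] unfolding in_different_atoms_def by blast
qed

lemma atom_of_measurable:
  assumes "finite_measurable_partition M \<xi>"
  shows "atom_of \<xi> \<in> measurable M (count_space \<xi>)"
proof -
  have \<xi>: "partition_on (space M) \<xi>" "\<xi> \<subseteq> sets M" "finite \<xi>"
    using assms by (auto simp: finite_measurable_partition_def)
  have "atom_of \<xi> -` {C} \<inter> space M = C" if "C \<in> \<xi>" for C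
  proof
    show "atom_of \<xi> -` {C} \<inter> space M \<subseteq> C"
      using atom_of_mem(2)[OF \<xi>(1)] by blast
    show "C \<subseteq> atom_of \<xi> -` {C} \<inter> space M"
      using atom_of_eq[OF \<xi>(1) that] sets.sets_into_space[of C M] \<xi>(2) that by blast
  qed
  then show ?thesis
    using \<xi>(2) atom_of_mem(1)[OF \<xi>(1)] by (subst measurable_count_space_eq2[OF \<xi>(3)]) (auto simp: subset_iff)
qed

text \<open>The same \<open>\<delta>\<close> and points work; only time 0 has to be dropped from
  \<open>F\<close>.\<close>

lemma n_sensitive_partition_imp_weakly_n_sensitive_partition:
  assumes "n_sensitive_partition M T n \<xi>"
  shows "weakly_n_sensitive_partition M T n \<xi>"
proof -
  obtain \<delta> :: real where \<delta>: "\<delta> > 0" "\<And>A. A \<in> sets M \<Longrightarrow> measure M A > 0 \<Longrightarrow>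
      \<exists>x F. (\<forall>i<n. x i \<in> A) \<and> inj_on x {..<n} \<and> lower_density F > ereal \<delta> \<and>
        (\<forall>k\<in>F. in_different_atoms \<xi> n (\<lambda>i. (T ^^ k) (x i)))"
    using assms unfolding n_sensitive_partition_def by blast
  show ?thesis
    unfolding weakly_n_sensitive_partition_def
  proof (intro exI[of _ \<delta>] conjI ballI impI \<delta>(1))
    fix A assume "A \<in> sets M" "measure M A > 0"
    from \<delta>(2)[OF this] obtain x F where F: "\<forall>i<n. x i \<in> A" "inj_on x {..<n}"
        "lower_density F > ereal \<delta>" "\<forall>k\<in>F. in_different_atoms \<xi> n (\<lambda>i. (T ^^ k) (x i))"
      by blast
    moreover have "upper_density (F - {0}) \<ge> ereal \<delta>"
      using F(3) lower_density_Diff_0[of F] lower_density_le_upper_density[of "F - {0}"] by simp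
    moreover have "F - {0} \<subseteq> {1..}" by (auto simp: Suc_le_eq)
    ultimately show "\<exists>x F. (\<forall>i<n. x i \<in> A) \<and> inj_on x {..<n} \<and> F \<subseteq> {1..} \<and>
        upper_density F \<ge> ereal \<delta> \<and> (\<forall>k\<in>F. in_different_atoms \<xi> n (\<lambda>i. (T ^^ k) (x i)))"
      by (intro exI[of _ x] exI[of _ "F - {0}"]) blast
  qed
qed

lemma (in prob_space) weakly_n_sensitive_partition_imp_n_sensitive_partition:
  assumes T: "T \<in> measurable M M" "distr M M T = M"
    and \<xi>: "finite_measurable_partition M \<xi>" and "n > 0"
    and weak: "weakly_n_sensitive_partition M T n \<xi>"
  shows "n_sensitive_partition M T n \<xi>"
proof -
  have part: "partition_on (space M) \<xi>" "finite \<xi>"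
    using \<xi> by (auto simp: finite_measurable_partition_def)
  define sep where "sep x = {k. inj_on (\<lambda>i. atom_of \<xi> ((T ^^ k) (x i))) {..<n}}" for x :: "nat \<Rightarrow> 'a"
  have sep_iff: "in_different_atoms \<xi> n (\<lambda>i. (T ^^ k) (x i)) \<longleftrightarrow> k \<in> sep x"
    if "\<And>i. i < n \<Longrightarrow> x i \<in> space M" for x k
    using that measurable_space[OF measurable_compose_n[OF T(1)]]
    unfolding sep_def mem_Collect_eq by (intro in_different_atoms_iff[OF part(1)]) blast
  obtain \<delta> :: real where \<delta>: "\<delta> > 0" "\<And>A. A \<in> sets M \<Longrightarrow> measure M A > 0 \<Longrightarrow>
      \<exists>x F. (\<forall>i<n. x i \<in> A) \<and> inj_on x {..<n} \<and> F \<subseteq> {1..} \<and> upper_density F \<ge> ereal \<delta> \<and>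
        (\<forall>k\<in>F. in_different_atoms \<xi> n (\<lambda>i. (T ^^ k) (x i)))"
    using weak unfolding weakly_n_sensitive_partition_def by blast
  \<comment> \<open>This \<open>m\<close> makes the isolation term less than
    \<open>\<delta> / 2\<close>.\<close>
  obtain m :: nat where m: "real n * card \<xi> / (\<delta> / 2) < real m"
    using reals_Archimedean2 by blast
  define K where "K = card {J. J \<subseteq> {..m} \<and> card J = n}"
  \<comment> \<open>Chosen after \<open>m\<close>, so that \<open>K * \<epsilon>\<close> is at most
    \<open>\<delta> / 2\<close>; the \<open>+ 1\<close> guards against \<open>K = 0\<close>.\<close>
  define \<epsilon> where "\<epsilon> = \<delta> / (2 * (real K + 1))"
  have "\<epsilon> > 0" using \<delta>(1) by (simp add: \<epsilon>_def)
  have "real n * card \<xi> < \<delta> / 2 * real (Suc m)"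
    using m \<delta>(1) by (simp add: field_simps)
  then have "n * (card \<xi> / real (Suc m)) < \<delta> / 2"
    by (simp add: divide_less_eq)
  moreover have "K * \<epsilon> \<le> \<delta> / 2"
    using \<delta>(1) by (simp add: \<epsilon>_def field_simps)
  ultimately have less: "K * \<epsilon> + n * (card \<xi> / real (Suc m)) < \<delta>" by linarith
  show ?thesis
    unfolding n_sensitive_partition_def
  proof (intro exI[of _ \<epsilon>] conjI ballI impI \<open>\<epsilon> > 0\<close>, rule ccontr)
    fix A assume A: "A \<in> sets M" "measure M A > 0"
      and no: "\<not> (\<exists>x F. (\<forall>i<n. x i \<in> A) \<and> inj_on x {..<n} \<and> lower_density F > ereal \<epsilon> \<and>
        (\<forall>k\<in>F. in_different_atoms \<xi> n (\<lambda>i. (T ^^ k) (x i))))"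
    have small: "lower_density (sep x) \<le> ereal \<epsilon>" if x: "\<And>i. i < n \<Longrightarrow> x i \<in> A" for x
    proof (cases "inj_on x {..<n}")
      case True
      have "x i \<in> space M" if "i < n" for i
        using x[OF that] sets.sets_into_space[OF A(1)] by blast
      then have "\<forall>k\<in>sep x. in_different_atoms \<xi> n (\<lambda>i. (T ^^ k) (x i))"
        using sep_iff[of x] by blast
      then show ?thesis using no True x by (meson not_le)
    next
      case False
      \<comment> \<open>A repeated point shares its atom with itself at all times, so such a tuple
        is never separated and the density is 0.\<close>
      then obtain i j where "i < n" "j < n" "i \<noteq> j" "x i = x j" by (auto simp: inj_on_def)
      then have "k \<notin> sep x" for k unfolding sep_def mem_Collect_eq inj_on_def by (metis lessThan_iff)
      then have "sep x = {}" by blast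
      then show ?thesis using \<open>\<epsilon> > 0\<close> by (simp add: lower_density_def Liminf_const)
    qed
    have "emeasure M A > 0" using A(2) by (simp add: emeasure_eq_measure)
    from refine_to_small_upper_density[where \<epsilon> = \<epsilon> and m = m, OF T part(2) atom_of_measurable[OF \<xi>]
        A(1) this \<open>n > 0\<close>, folded sep_def K_def, OF small]
    obtain B where B: "B \<in> sets M" "emeasure M B > 0"
      and up: "\<And>x. \<forall>i<n. x i \<in> B \<Longrightarrow>
        upper_density (sep x) \<le> ereal (K * \<epsilon> + n * (card \<xi> / real (Suc m)))"
      by blast
    have "measure M B > 0" using B(2) by (simp add: emeasure_eq_measure)
    from \<delta>(2)[OF B(1) this] obtain x F where F: "\<forall>i<n. x i \<in> B" "upper_density F \<ge> ereal \<delta>"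
        "\<forall>k\<in>F. in_different_atoms \<xi> n (\<lambda>i. (T ^^ k) (x i))"
      by blast
    have "F \<subseteq> sep x"
    proof
      fix k assume "k \<in> F"
      moreover have "x i \<in> space M" if "i < n" for i
        using F(1) that sets.sets_into_space[OF B(1)] by blast
      ultimately show "k \<in> sep x" using F(3) sep_iff by blast
    qed
    then have "ereal \<delta> \<le> upper_density (sep x)"
      using F(2) upper_density_mono order.trans by blast
    also note up[OF F(1)]
    finally show False using less by simp
  qed
qed

theorem theorem4p2:
  fixes M :: "'a measure" and T :: "'a \<Rightarrow> 'a" and n :: nat
  assumes "mt_dynamical_system M T"
    and "ergodic_transformation M T"
    and "n \<ge> 2"
  shows "n_sensitive M T n \<longleftrightarrow> weakly_n_sensitive M T n"
proof -
  interpret prob_space M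
    using assms(1) by (simp add: mt_dynamical_system_def lebesgue_probability_space_def)
  have T: "T \<in> measurable M M" "distr M M T = M"
    using assms(1) by (auto simp: mt_dynamical_system_def invertible_measure_preserving_def)
  have "n > 0" using assms(3) by simp
  \<comment> \<open>The equivalence is proved for each partition separately.\<close>
  then have "n_sensitive_partition M T n \<xi> \<longleftrightarrow> weakly_n_sensitive_partition M T n \<xi>"
    if "finite_measurable_partition M \<xi>" for \<xi>
    using n_sensitive_partition_imp_weakly_n_sensitive_partition weakly_n_sensitive_partition_imp_n_sensitive_partition[OF T that] by blast
  then show ?thesis
    unfolding n_sensitive_def weakly_n_sensitive_def by blast
qed

end
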